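(* Let $F=(0,0)$ and let $\mathcal{F}=\{\mathcal{P}(p)\mid p\in\mathbb{R}\setminus\{0\}\}$ be the confocal family of parabolas $\mathcal{P}(p): y^2=2px+p^2$. Let $\mathcal{D}=\mathcal{D}(E)$ be a circle centered at $E\in\mathbb{R}^2$. Let $\ell'$ be the line through $F$ parallel to the directrices of the parabolas in $\mathcal{F}$ (i.e. $\ell'$ is the line $x=0$). Then: a) If $E\in\ell'$, then for $\mathcal{P}\in\mathcal{F}$, $(\mathcal{D},\mathcal{P})$ is a $4$-Poncelet pair if and only if $E=F$. b) There is a unique $\mathcal{P}\in\mathcal{F}$ such that $(\mathcal{D},\mathcal{P})$ is a $4$-Poncelet pair if and only if $E\notin\ell'$ and $F\notin\mathcal{D}$.
   Context: Every parabola $\mathcal{P}(p)$ has focus $F=(0,0)$, the $x$-axis as axis of symmetry and directrix $x=-p$. $F\notin\mathcal{D}$ means that $F$ does not lie on the circle $\mathcal{D}$. Real conics are identified with their complexifications in $\mathbb{CP}^2$, and polygons are taken in $\mathbb{CP}^2$ (vertices and sides may be non-real). For $n\ge 3$ and two smooth conics $\mathcal{C}_1,\mathcal{C}_2$, an $n$-Poncelet polygon is an $n$-gon ($n$ distinct vertices, $n$ distinct side lines) whose vertices lie on $\mathcal{C}_1$ and whose side lines are tangent to $\mathcal{C}_2$; a $k$-gon traversed $m>1$ times is not regarded as an $mk$-gon. The pair $(\mathcal{C}_1,\mathcal{C}_2)$ is an $n$-Poncelet pair if such an $n$-gon exists. *)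

theory Defs
  imports "HOL-Analysis.Analysis"
begin

section \<open>The complex projective plane\<close>

definition proportional :: "complex^3 \<Rightarrow> complex^3 \<Rightarrow> bool" where
  "proportional u v \<longleftrightarrow> u \<noteq> 0 \<and> v \<noteq> 0 \<and> (\<exists>c. c \<noteq> 0 \<and> v = c *s u)"

lemma proportional_part_equivp: "part_equivp proportional"
proof (rule part_equivpI)
  have "proportional 1 1"
    unfolding proportional_def by (auto intro!: exI[of _ 1])
  then show "\<exists>x. proportional x x" by blast
  show "symp proportional"
  proof (rule sympI)
    fix u v assume uv: "proportional u v"
    then obtain c where "c \<noteq> 0" "v = c *s u" by (auto simp: proportional_def)
    then have "inverse c \<noteq> 0" "u = inverse c *s v" by (auto simp: vec_eq_iff)
    with uv show "proportional v u" unfolding proportional_def by blast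
  qed
  show "transp proportional"
  proof (rule transpI)
    fix u v w assume uv: "proportional u v" and vw: "proportional v w"
    obtain c where c: "c \<noteq> 0" "v = c *s u" using uv by (auto simp: proportional_def)
    obtain d where d: "d \<noteq> 0" "w = d *s v" using vw by (auto simp: proportional_def)
    have "d * c \<noteq> 0" "w = (d * c) *s u" using c d by (auto simp: vec_eq_iff)
    with uv vw show "proportional u w" unfolding proportional_def by blast
  qed
qed

quotient_type cp2 = "complex^3" / partial: proportional
  by (rule proportional_part_equivp)

text \<open>The line \<open>a x + b y + c z = 0\<close> is identified with the class of its coefficient
  vector \<open>(a, b, c)\<close>, so lines form another copy of the projective plane.\<close>

type_synonym cp2_line = cp2

lift_definition incident :: "cp2 \<Rightarrow> cp2_line \<Rightarrow> bool" is
  "\<lambda>u l. (\<Sum>i\<in>UNIV. l $ i * u $ i) = 0"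
proof -
  fix u u' l l' :: "complex^3"
  assume "proportional u u'" "proportional l l'"
  then obtain c d where "c \<noteq> 0" "u' = c *s u" "d \<noteq> 0" "l' = d *s l"
    by (auto simp: proportional_def)
  moreover have "(\<Sum>i\<in>UNIV. (d *s l) $ i * (c *s u) $ i) = d * c * (\<Sum>i\<in>UNIV. l $ i * u $ i)"
    by (simp add: sum_distrib_left algebra_simps)
  ultimately show "((\<Sum>i\<in>UNIV. l $ i * u $ i) = 0) = ((\<Sum>i\<in>UNIV. l' $ i * u' $ i) = 0)"
    by simp
qed

definition affine_point :: "real \<times> real \<Rightarrow> cp2" where
  "affine_point P = abs_cp2 (vector [of_real (fst P), of_real (snd P), 1])"


section \<open>Conics\<close>

text \<open>A conic is a nonzero ternary quadratic form up to a nonzero factor; the form is given by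
  its symmetric matrix \<open>A\<close>.\<close>

definition conic_equiv :: "complex^3^3 \<Rightarrow> complex^3^3 \<Rightarrow> bool" where
  "conic_equiv A B \<longleftrightarrow> A \<noteq> 0 \<and> B \<noteq> 0 \<and> transpose A = A \<and> transpose B = B \<and>
     (\<exists>c. c \<noteq> 0 \<and> B = mat c ** A)"

lemma conic_equiv_part_equivp: "part_equivp conic_equiv"
proof (rule part_equivpI)
  have "(mat 1 :: complex^3^3) \<noteq> 0"
    by (auto simp: vec_eq_iff mat_def)
  then have "conic_equiv (mat 1) (mat 1)"
    unfolding conic_equiv_def by (auto intro!: exI[of _ 1] simp: matrix_mul_lid)
  then show "\<exists>x. conic_equiv x x" by blast
  have mm: "mat c ** (mat d ** A) = mat (c * d) ** A" for c d :: complex and A :: "complex^3^3"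
    by (simp add: vec_eq_iff matrix_matrix_mult_def mat_def if_distrib if_distribR
        cong: if_cong)
  show "symp conic_equiv"
  proof (rule sympI)
    fix A B assume AB: "conic_equiv A B"
    then obtain c where c: "c \<noteq> 0" "B = mat c ** A" by (auto simp: conic_equiv_def)
    then have "inverse c \<noteq> 0" "A = mat (inverse c) ** B" by (auto simp: mm)
    with AB show "conic_equiv B A" unfolding conic_equiv_def by blast
  qed
  show "transp conic_equiv"
  proof (rule transpI)
    fix A B C assume AB: "conic_equiv A B" and BC: "conic_equiv B C"
    obtain c where c: "c \<noteq> 0" "B = mat c ** A" using AB by (auto simp: conic_equiv_def)
    obtain d where d: "d \<noteq> 0" "C = mat d ** B" using BC by (auto simp: conic_equiv_def)
    have "d * c \<noteq> 0" "C = mat (d * c) ** A" using c d by (auto simp: mm)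
    with AB BC show "conic_equiv A C" unfolding conic_equiv_def by blast
  qed
qed

quotient_type plane_conic = "complex^3^3" / partial: conic_equiv
  by (rule conic_equiv_part_equivp)

lemma mat_mult_vector: "(mat c ** A) *v u = c *s (A *v u)"
  for A :: "complex^3^3" and u :: "complex^3"
  by (simp add: vec_eq_iff matrix_matrix_mult_def matrix_vector_mult_def mat_def if_distrib
      if_distribR sum_distrib_left algebra_simps cong: if_cong)

lemma conic_equiv_proportionalD:
  assumes "conic_equiv A B" "proportional u v"
  obtains c d where "c \<noteq> 0" "d \<noteq> 0" "v = c *s u" "B *v v = d *s (A *v u)"
proof -
  obtain c where c: "c \<noteq> 0" "v = c *s u" using assms(2) by (auto simp: proportional_def)
  obtain d where d: "d \<noteq> 0" "B = mat d ** A" using assms(1) by (auto simp: conic_equiv_def)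
  have "B *v v = (d * c) *s (A *v u)"
    by (simp add: c d mat_mult_vector vec.scale)
  then show thesis using that[of c "d * c"] c d by simp
qed

lift_definition on_conic :: "cp2 \<Rightarrow> plane_conic \<Rightarrow> bool" is
  "\<lambda>u A. (\<Sum>i\<in>UNIV. u $ i * (A *v u) $ i) = 0"
proof -
  fix u v :: "complex^3" and A B :: "complex^3^3"
  assume "proportional u v" "conic_equiv A B"
  then obtain c d where "c \<noteq> 0" "d \<noteq> 0" "v = c *s u" "B *v v = d *s (A *v u)"
    by (metis conic_equiv_proportionalD)
  moreover have "(\<Sum>i\<in>UNIV. (c *s u) $ i * (d *s (A *v u)) $ i) =
      c * d * (\<Sum>i\<in>UNIV. u $ i * (A *v u) $ i)"
    by (simp add: sum_distrib_left algebra_simps)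
  ultimately show "((\<Sum>i\<in>UNIV. u $ i * (A *v u) $ i) = 0) =
      ((\<Sum>i\<in>UNIV. v $ i * (B *v v) $ i) = 0)"
    by simp
qed

lift_definition smooth_conic :: "plane_conic \<Rightarrow> bool" is "\<lambda>A. det A \<noteq> 0"
  by (auto simp: conic_equiv_def det_mul mat_def det_diagonal)

text \<open>The gradient of \<open>u\<^sup>T A u\<close> at \<open>u\<close> is \<open>2 A u\<close>, so on a smooth conic the tangent line at \<open>u\<close> has
  coefficient vector \<open>A u\<close>.\<close>

lift_definition tangent_at :: "plane_conic \<Rightarrow> cp2 \<Rightarrow> cp2_line \<Rightarrow> bool" is
  "\<lambda>A u l. (\<Sum>i\<in>UNIV. u $ i * (A *v u) $ i) = 0 \<and> proportional (A *v u) l"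
proof -
  fix A B :: "complex^3^3" and u v l m :: "complex^3"
  assume AB: "conic_equiv A B" and uv: "proportional u v" and lm: "proportional l m"
  obtain c d where cd: "c \<noteq> 0" "d \<noteq> 0" "v = c *s u" "B *v v = d *s (A *v u)"
    using AB uv by (rule conic_equiv_proportionalD)
  have "(\<Sum>i\<in>UNIV. (c *s u) $ i * (d *s (A *v u)) $ i) =
      c * d * (\<Sum>i\<in>UNIV. u $ i * (A *v u) $ i)"
    by (simp add: sum_distrib_left algebra_simps)
  then have on: "(\<Sum>i\<in>UNIV. v $ i * (B *v v) $ i) = 0 \<longleftrightarrow> (\<Sum>i\<in>UNIV. u $ i * (A *v u) $ i) = 0"
    using cd by simp
  have "proportional (B *v v) m \<longleftrightarrow> proportional (A *v u) l"
  proof (cases "A *v u = 0")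
    case True
    then show ?thesis using cd by (simp add: proportional_def)
  next
    case False
    then have "proportional (A *v u) (B *v v)"
      using cd by (auto simp: proportional_def vec_eq_iff)
    then show ?thesis
      using lm proportional_part_equivp by (meson part_equivp_symp part_equivp_transp)
  qed
  with on show "((\<Sum>i\<in>UNIV. u $ i * (A *v u) $ i) = 0 \<and> proportional (A *v u) l) =
      ((\<Sum>i\<in>UNIV. v $ i * (B *v v) $ i) = 0 \<and> proportional (B *v v) m)"
    by simp
qed

definition tangent_to :: "cp2_line \<Rightarrow> plane_conic \<Rightarrow> bool" where
  "tangent_to l C \<longleftrightarrow> (\<exists>P. tangent_at C P l)"

text \<open>The complexification of the real affine conic
  \<open>a x\<^sup>2 + b x y + c y\<^sup>2 + d x + e y + f = 0\<close>; meaningful if the coefficients are not all zero.\<close>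

definition real_conic_matrix ::
  "real \<Rightarrow> real \<Rightarrow> real \<Rightarrow> real \<Rightarrow> real \<Rightarrow> real \<Rightarrow> complex^3^3" where
  "real_conic_matrix a b c d e f =
     vector [vector [of_real a,       of_real (b / 2), of_real (d / 2)],
             vector [of_real (b / 2), of_real c,       of_real (e / 2)],
             vector [of_real (d / 2), of_real (e / 2), of_real f]]"

definition real_conic :: "real \<Rightarrow> real \<Rightarrow> real \<Rightarrow> real \<Rightarrow> real \<Rightarrow> real \<Rightarrow> plane_conic" where
  "real_conic a b c d e f = abs_plane_conic (real_conic_matrix a b c d e f)"

definition circle :: "real \<times> real \<Rightarrow> real \<Rightarrow> plane_conic" where
  "circle E r = real_conic 1 0 1 (- 2 * fst E) (- 2 * snd E) ((fst E)\<^sup>2 + (snd E)\<^sup>2 - r\<^sup>2)"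

definition parabola :: "real \<Rightarrow> plane_conic" where
  "parabola p = real_conic 0 0 1 (- 2 * p) 0 (- p\<^sup>2)"

definition confocal_family :: "plane_conic set" where
  "confocal_family = {parabola p |p. p \<noteq> 0}"

definition focus :: "real \<times> real" where
  "focus = (0, 0)"

text \<open>The directrix of \<open>parabola p\<close> is the line \<open>x = - p\<close>, so its parallel through the focus
  is \<open>x = 0\<close>.\<close>

definition directrix_parallel :: "(real \<times> real) set" where
  "directrix_parallel = {(x, y). x = 0}"


section \<open>Poncelet polygons\<close>

text \<open>The vertices are \<open>v 0, \<dots>, v (n - 1)\<close>; the side line \<open>l i\<close> joins \<open>v i\<close> to its cyclic
  successor.  Distinctness excludes polygons traversed several times.\<close>

definition poncelet_polygon ::
  "nat \<Rightarrow> plane_conic \<Rightarrow> plane_conic \<Rightarrow> (nat \<Rightarrow> cp2) \<Rightarrow> (nat \<Rightarrow> cp2_line) \<Rightarrow> bool" where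
  "poncelet_polygon n C1 C2 v l \<longleftrightarrow>
     inj_on v {..<n} \<and> inj_on l {..<n} \<and>
     (\<forall>i<n. incident (v i) (l i) \<and> incident (v (Suc i mod n)) (l i)) \<and>
     (\<forall>i<n. on_conic (v i) C1) \<and> (\<forall>i<n. tangent_to (l i) C2)"

definition poncelet_pair :: "nat \<Rightarrow> plane_conic \<Rightarrow> plane_conic \<Rightarrow> bool" where
  "poncelet_pair n C1 C2 \<longleftrightarrow>
     n \<ge> 3 \<and> smooth_conic C1 \<and> smooth_conic C2 \<and> (\<exists>v l. poncelet_polygon n C1 C2 v l)"


section \<open>Agreement with the real affine picture\<close>

lemma real_conic_matrix_symmetric:
  "transpose (real_conic_matrix a b c d e f) = real_conic_matrix a b c d e f"
  by (simp add: real_conic_matrix_def vec_eq_iff forall_3 transpose_def vector_3)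

lemma real_conic_matrix_refl:
  assumes "c \<noteq> 0"
  shows "conic_equiv (real_conic_matrix a b c d e f) (real_conic_matrix a b c d e f)"
proof -
  have "real_conic_matrix a b c d e f $ 2 $ 2 \<noteq> 0"
    using assms by (simp add: real_conic_matrix_def vector_3)
  then have "real_conic_matrix a b c d e f \<noteq> 0"
    by (metis zero_index)
  then show ?thesis
    unfolding conic_equiv_def
    by (auto intro!: exI[of _ 1] simp: matrix_mul_lid real_conic_matrix_symmetric)
qed

lemma affine_point_refl:
  "proportional (vector [of_real x, of_real y, 1]) (vector [of_real x, of_real y, 1])"
  unfolding proportional_def by (auto intro!: exI[of _ 1] simp: vec_eq_iff forall_3 vector_3)

lemma on_real_conic_iff:
  assumes "c \<noteq> 0"
  shows "on_conic (affine_point (x, y)) (real_conic a b c d e f) \<longleftrightarrow>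
    a * x\<^sup>2 + b * x * y + c * y\<^sup>2 + d * x + e * y + f = 0"
proof -
  let ?q = "a * x\<^sup>2 + b * x * y + c * y\<^sup>2 + d * x + e * y + f"
  have "on_conic (affine_point (x, y)) (real_conic a b c d e f) \<longleftrightarrow> complex_of_real ?q = 0"
    unfolding affine_point_def real_conic_def fst_conv snd_conv
      on_conic.abs_eq[OF affine_point_refl real_conic_matrix_refl[OF assms]]
    by (simp add: sum_3 matrix_vector_mult_def real_conic_matrix_def vector_3 algebra_simps
        power2_eq_square)
  then show ?thesis by (simp only: of_real_eq_0_iff)
qed

lemma on_parabola_iff: "on_conic (affine_point (x, y)) (parabola p) \<longleftrightarrow> y\<^sup>2 = 2 * p * x + p\<^sup>2"
  by (auto simp: parabola_def on_real_conic_iff)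

lemma on_circle_iff:
  assumes "r > 0"
  shows "on_conic (affine_point P) (circle E r) \<longleftrightarrow> dist P E = r"
proof -
  obtain x y a b where PE: "P = (x, y)" "E = (a, b)" by fastforce
  have "dist P E = r \<longleftrightarrow> (x - a)\<^sup>2 + (y - b)\<^sup>2 = r\<^sup>2"
    using assms real_sqrt_unique[of r] by (auto simp: PE dist_Pair_Pair dist_real_def)
  then show ?thesis
    by (auto simp: PE circle_def on_real_conic_iff power2_diff algebra_simps)
qed

lemma smooth_real_conic_iff:
  assumes "c \<noteq> 0"
  shows "smooth_conic (real_conic a b c d e f) \<longleftrightarrow> det (real_conic_matrix a b c d e f) \<noteq> 0"
  unfolding real_conic_def smooth_conic.abs_eq[OF real_conic_matrix_refl[OF assms]] ..

lemma smooth_circle: "r > 0 \<Longrightarrow> smooth_conic (circle E r)"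
  unfolding circle_def
  by (simp add: smooth_real_conic_iff real_conic_matrix_def det_3 vector_3 power2_eq_square
      algebra_simps)

lemma smooth_parabola: "p \<noteq> 0 \<Longrightarrow> smooth_conic (parabola p)"
  unfolding parabola_def
  by (simp add: smooth_real_conic_iff real_conic_matrix_def det_3 vector_3)

end

theory Submission
  imports Defs
begin

text \<open>
  The tangent lines of \<open>parabola p\<close> are parametrised by \<open>[s : t]\<close> via
  \<open>(2 s\<^sup>2, 2 s t, p (s\<^sup>2 + t\<^sup>2))\<close>, and two of them meet on the circle iff their parameters satisfy a
  symmetric \<open>(2, 2)\<close>-correspondence, i.e. a symmetric bilinear form \<open>M\<close> in \<open>(t\<^sup>2, s t, s\<^sup>2)\<close>.
  A Poncelet quadrilateral is a 4-cycle of the correspondence with distinct parameters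
  \<open>t\<^sub>0, \<dots>, t\<^sub>3\<close>; as \<open>M t\<^sub>0\<close> and \<open>M t\<^sub>2\<close> both annihilate \<open>t\<^sub>1\<close> and \<open>t\<^sub>3\<close>, they are proportional, so
  \<open>det M = 0\<close>. Conversely, if \<open>det M = 0\<close> the correspondence splits as
  \<open>\<phi> t * \<phi> u = const\<close> with \<open>\<phi>\<close> rational of degree 2, and two generic fibres of \<open>\<phi>\<close> form a
  quadrilateral. With \<open>E = (e\<^sub>1, e\<^sub>2)\<close>, the determinant vanishes iff
  \<open>e\<^sub>1 (|E|\<^sup>2 - r\<^sup>2) + p |E|\<^sup>2 = 0\<close>, a linear equation in \<open>p\<close>.
\<close>

section \<open>Homogeneous coordinates for points and lines\<close>

definition hom :: "complex \<Rightarrow> complex \<Rightarrow> complex \<Rightarrow> cp2" where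
  "hom x y z = abs_cp2 (vector [x, y, z])"

lemma vector_3_eq_0_iff: "(vector [x, y, z] :: complex^3) = 0 \<longleftrightarrow> x = 0 \<and> y = 0 \<and> z = 0"
  by (simp add: vec_eq_iff forall_3 vector_3)

lemma vector_3_components: "u = vector [u $ 1, u $ 2, u $ 3]" for u :: "complex^3"
  by (simp add: vec_eq_iff forall_3 vector_3)

lemma proportional_refl_iff: "proportional u u \<longleftrightarrow> u \<noteq> 0"
  unfolding proportional_def by (auto intro!: exI[of _ 1])

lemma proportional_vector_3_iff:
  "proportional (vector [x, y, z]) (vector [x', y', z']) \<longleftrightarrow>
    (x, y, z) \<noteq> (0, 0, 0) \<and> (\<exists>c. c \<noteq> 0 \<and> x' = c * x \<and> y' = c * y \<and> z' = c * z)"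
  unfolding proportional_def
  by (auto simp: vector_3_eq_0_iff) (auto simp: vec_eq_iff forall_3 vector_3)

lemma hom_cases:
  obtains x y z where "(x, y, z) \<noteq> (0, 0, 0)" "P = hom x y z"
proof (induction P rule: cp2.abs_induct)
  case (1 u)
  then show ?case
    using vector_3_components[of u]
    by (metis hom_def proportional_refl_iff vector_3_eq_0_iff prod.inject)
qed

lemma hom_eq_iff:
  assumes "(x, y, z) \<noteq> (0, 0, 0)" "(x', y', z') \<noteq> (0, 0, 0)"
  shows "hom x y z = hom x' y' z' \<longleftrightarrow>
    (\<exists>c. c \<noteq> 0 \<and> x' = c * x \<and> y' = c * y \<and> z' = c * z)"
proof -
  have "proportional (vector [x, y, z]) (vector [x, y, z])"
       "proportional (vector [x', y', z']) (vector [x', y', z'])"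
    using assms by (auto simp: proportional_refl_iff vector_3_eq_0_iff)
  then have "hom x y z = hom x' y' z' \<longleftrightarrow> proportional (vector [x, y, z]) (vector [x', y', z'])"
    unfolding hom_def using Quotient3_rel[OF Quotient3_cp2] by blast
  then show ?thesis
    using assms by (simp add: proportional_vector_3_iff)
qed

lemma incident_hom:
  assumes "(x, y, z) \<noteq> (0, 0, 0)" "(a, b, c) \<noteq> (0, 0, 0)"
  shows "incident (hom x y z) (hom a b c) \<longleftrightarrow> a * x + b * y + c * z = 0"
  using assms unfolding hom_def
  by (subst incident.abs_eq) (auto simp: proportional_refl_iff vector_3_eq_0_iff sum_3 vector_3)

section \<open>The circle and the tangent lines of the parabola in coordinates\<close>

definition circle_form :: "real \<times> real \<Rightarrow> real \<Rightarrow> complex \<Rightarrow> complex \<Rightarrow> complex \<Rightarrow> complex" where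
  "circle_form E r x y z =
    (x - of_real (fst E) * z)\<^sup>2 + (y - of_real (snd E) * z)\<^sup>2 - (of_real r * z)\<^sup>2"

lemma on_circle_hom:
  assumes "(x, y, z) \<noteq> (0, 0, 0)"
  shows "on_conic (hom x y z) (circle E r) \<longleftrightarrow> circle_form E r x y z = 0"
proof -
  have "proportional (vector [x, y, z]) (vector [x, y, z])"
    using assms by (auto simp: proportional_refl_iff vector_3_eq_0_iff)
  then show ?thesis
    unfolding hom_def circle_def real_conic_def circle_form_def
    by (subst on_conic.abs_eq[OF _ real_conic_matrix_refl])
       (simp_all add: sum_3 matrix_vector_mult_def real_conic_matrix_def vector_3 algebra_simps
        power2_eq_square)
qed

lemma tangent_at_parabola_hom:
  assumes "(x, y, z) \<noteq> (0, 0, 0)" "(a, b, c) \<noteq> (0, 0, 0)"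
  shows "tangent_at (parabola p) (hom x y z) (hom a b c) \<longleftrightarrow>
    y\<^sup>2 = 2 * of_real p * x * z + (of_real p * z)\<^sup>2 \<and>
    (\<exists>k. k \<noteq> 0 \<and> a = - k * of_real p * z \<and> b = k * y \<and>
        c = - k * of_real p * (x + of_real p * z))"
proof -
  let ?A = "real_conic_matrix 0 0 1 (- 2 * p) 0 (- p\<^sup>2)"
  let ?u = "vector [x, y, z] :: complex^3" and ?l = "vector [a, b, c] :: complex^3"
  have A: "?A *v ?u = vector [- of_real p * z, y, - of_real p * (x + of_real p * z)]"
    by (simp add: vec_eq_iff forall_3 matrix_vector_mult_def sum_3 real_conic_matrix_def vector_3
        algebra_simps power2_eq_square)
  have "proportional ?u ?u" "proportional ?l ?l"
    using assms by (auto simp: proportional_refl_iff vector_3_eq_0_iff)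
  then have "tangent_at (parabola p) (hom x y z) (hom a b c) \<longleftrightarrow>
      (\<Sum>i\<in>UNIV. ?u $ i * (?A *v ?u) $ i) = 0 \<and> proportional (?A *v ?u) ?l"
    unfolding hom_def parabola_def real_conic_def
    by (subst tangent_at.abs_eq[OF real_conic_matrix_refl]) auto
  also have "(\<Sum>i\<in>UNIV. ?u $ i * (?A *v ?u) $ i) = y\<^sup>2 - (2 * of_real p * x * z + (of_real p * z)\<^sup>2)"
    unfolding A by (simp add: sum_3 vector_3 algebra_simps power2_eq_square)
  also have "proportional (?A *v ?u) ?l \<longleftrightarrow> (\<exists>k. k \<noteq> 0 \<and> a = - k * of_real p * z \<and> b = k * y \<and>
        c = - k * of_real p * (x + of_real p * z))"
    using assms(2) unfolding A proportional_vector_3_iff by (auto simp: mult.assoc)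
  finally show ?thesis by simp
qed

definition tangent_line :: "real \<Rightarrow> complex \<Rightarrow> complex \<Rightarrow> cp2_line" where
  "tangent_line p s t = hom (2 * s\<^sup>2) (2 * s * t) (of_real p * (s\<^sup>2 + t\<^sup>2))"

lemma tangent_to_parabola_iff:
  assumes "p \<noteq> 0"
  shows "tangent_to m (parabola p) \<longleftrightarrow>
    (\<exists>s t. (s, t) \<noteq> (0, 0) \<and> m = tangent_line p s t)"
proof
  assume "tangent_to m (parabola p)"
  then obtain P where P: "tangent_at (parabola p) P m"
    by (auto simp: tangent_to_def)
  obtain x y z where xyz: "(x, y, z) \<noteq> (0, 0, 0)" "P = hom x y z" by (rule hom_cases)
  obtain a b c where abc: "(a, b, c) \<noteq> (0, 0, 0)" "m = hom a b c" by (rule hom_cases)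
  obtain k where k: "k \<noteq> 0" "y\<^sup>2 = 2 * of_real p * x * z + (of_real p * z)\<^sup>2"
    "a = - k * of_real p * z" "b = k * y" "c = - k * of_real p * (x + of_real p * z)"
    using P xyz abc tangent_at_parabola_hom by auto
  \<comment> \<open>The equation of the dual conic; on it \<open>b / a\<close> is a rational
    parameter, which becomes \<open>t / s\<close>.\<close>
  have dual: "of_real p * (a\<^sup>2 + b\<^sup>2) = 2 * a * c"
    unfolding k(3-5) power_mult_distrib k(2) by (simp add: power2_eq_square algebra_simps)
  show "\<exists>s t. (s, t) \<noteq> (0, 0) \<and> m = tangent_line p s t"
  proof (cases "a = 0")
    case True
    \<comment> \<open>Only the line at infinity has \<open>a = 0\<close>; it is tangent to every
      parabola and has the parameter \<open>[0 : 1]\<close>.\<close>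
    then have "b = 0" "c \<noteq> 0" using dual assms abc(1) by auto
    then have "hom 0 0 (of_real p) = m"
      using True assms abc
      by (auto simp: hom_eq_iff intro!: exI[of _ "c / of_real p"])
    then show ?thesis by (intro exI[of _ 0] exI[of _ 1]) (simp add: tangent_line_def)
  next
    case False
    have "hom 2 (2 * (b / a)) (of_real p * (1 + (b / a)\<^sup>2)) = m"
      using False assms abc dual
      by (auto simp: hom_eq_iff field_simps power2_eq_square intro!: exI[of _ "a / 2"])
    then show ?thesis by (intro exI[of _ 1] exI[of _ "b / a"]) (simp add: tangent_line_def)
  qed
next
  assume "\<exists>s t. (s, t) \<noteq> (0, 0) \<and> m = tangent_line p s t"
  then obtain s t where st: "(s, t) \<noteq> (0, 0)" "m = tangent_line p s t" by blast
  \<comment> \<open>The point of contact is the limit of the intersection of two tangents as their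
    parameters coincide.\<close>
  have "tangent_at (parabola p) (hom (of_real p * (t\<^sup>2 - s\<^sup>2)) (- 2 * of_real p * s * t) (2 * s\<^sup>2)) m"
    unfolding st(2) tangent_line_def using st(1) assms
    by (subst tangent_at_parabola_hom)
       (auto simp: power2_eq_square algebra_simps intro!: exI[of _ "- 1 / of_real p"])
  then show "tangent_to m (parabola p)" by (auto simp: tangent_to_def)
qed

lemma zero_cross_imp_multiple:
  fixes x y z a b c :: "'a :: field"
  assumes "(a, b, c) \<noteq> (0, 0, 0)" "y * c = z * b" "z * a = x * c" "x * b = y * a"
  obtains k where "x = k * a" "y = k * b" "z = k * c"
proof -
  consider "a \<noteq> 0" | "b \<noteq> 0" | "c \<noteq> 0" using assms(1) by auto
  then show thesis
  proof cases
    case 1 then show ?thesis using that[of "x / a"] assms by (simp add: field_simps)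
  next
    case 2 then show ?thesis using that[of "y / b"] assms by (simp add: field_simps)
  next
    case 3 then show ?thesis using that[of "z / c"] assms by (simp add: field_simps)
  qed
qed

text \<open>The triple multiplied by \<open>k\<close> is the cross product of the two coefficient
  vectors divided by their common factor \<open>2 * (s * t' - t * s')\<close>. A vector annihilated
  by both lines is a multiple of it.\<close>

lemma tangents_intersection:
  fixes x y z s t s' t' p :: complex
  assumes "p \<noteq> 0" "s * t' \<noteq> t * s'"
    and 1: "2 * s\<^sup>2 * x + 2 * s * t * y + p * (s\<^sup>2 + t\<^sup>2) * z = 0"
    and 2: "2 * s'\<^sup>2 * x + 2 * s' * t' * y + p * (s'\<^sup>2 + t'\<^sup>2) * z = 0"
  obtains k where "x = k * (p * (t * t' - s * s'))" "y = k * (- p * (s * t' + t * s'))"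
    "z = k * (2 * s * s')"
proof (rule zero_cross_imp_multiple)
  let ?d = "s * t' - t * s'"
  have d: "?d \<noteq> 0" using assms(2) by simp
  show "(p * (t * t' - s * s'), - p * (s * t' + t * s'), 2 * s * s') \<noteq> (0, 0, 0)"
    using assms(1,2) by auto
  have "?d * (y * (2 * s * s') - z * (- p * (s * t' + t * s'))) = 0"
    using 1 2 by algebra
  with d show "y * (2 * s * s') = z * (- p * (s * t' + t * s'))"
    by (simp only: mult_eq_0_iff right_minus_eq) simp
  have "?d * (z * (p * (t * t' - s * s')) - x * (2 * s * s')) = 0"
    using 1 2 by algebra
  with d show "z * (p * (t * t' - s * s')) = x * (2 * s * s')" by simp
  have "?d * (x * (- p * (s * t' + t * s')) - y * (p * (t * t' - s * s'))) = 0"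
    using 1 2 by algebra
  with d show "x * (- p * (s * t' + t * s')) = y * (p * (t * t' - s * s'))" by simp
qed (use that in blast)

section \<open>A symmetric correspondence with a 4-cycle has determinant zero\<close>

definition veronese :: "complex \<Rightarrow> complex \<Rightarrow> complex^3" where
  "veronese s t = vector [t\<^sup>2, s * t, s\<^sup>2]"

text \<open>A homogeneous Vandermonde determinant: points of the Veronese conic with three distinct
  parameters are linearly independent.\<close>

lemma det_veronese:
  "det (vector [veronese s1 t1, veronese s2 t2, veronese s3 t3]) =
    (s1 * t2 - t1 * s2) * (s2 * t3 - t2 * s3) * (t1 * s3 - s1 * t3)"
  by (simp add: det_3 veronese_def vector_3) algebra

lemma symmetric_form_4_cycle_imp_det_eq_0:
  fixes M :: "complex^3^3" and s t :: "nat \<Rightarrow> complex"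
  defines "f \<equiv> \<lambda>i j. (\<Sum>k\<in>UNIV. veronese (s i) (t i) $ k * (M *v veronese (s j) (t j)) $ k)"
  assumes dist: "\<And>i j. i < 4 \<Longrightarrow> j < 4 \<Longrightarrow> i \<noteq> j \<Longrightarrow> s i * t j \<noteq> t i * s j"
    and cyc: "f 0 1 = 0" "f 0 3 = 0" "f 2 1 = 0" "f 2 3 = 0"
  shows "det M = 0"
proof -
  let ?v = "\<lambda>i. veronese (s i) (t i)"
  \<comment> \<open>The third rows only complete two bases. In these bases the cycle conditions put
    a zero 2 by 2 block in the upper left corner, so the first two rows of the product are both
    multiples of the third unit vector.\<close>
  let ?A = "vector [?v 0, ?v 2, ?v 1] :: complex^3^3"
  let ?B = "vector [?v 1, ?v 3, ?v 0] :: complex^3^3"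
  have "?A ** (M ** transpose ?B) = vector [vector [f 0 1, f 0 3, f 0 0],
      vector [f 2 1, f 2 3, f 2 0], vector [f 1 1, f 1 3, f 1 0]]"
    by (simp add: vec_eq_iff forall_3 vector_3 f_def matrix_matrix_mult_def transpose_def
        matrix_vector_mult_def)
  then have "det (?A ** (M ** transpose ?B)) = 0"
    by (simp add: det_3 vector_3 cyc del: One_nat_def)
  moreover have "det ?A \<noteq> 0" "det ?B \<noteq> 0"
    using dist unfolding det_veronese by (auto simp: eq_commute[of "t _ * _"])
  ultimately show ?thesis
    by (simp add: det_mul)
qed

section \<open>Explicit 4-cycles of split correspondences\<close>

lemma quadratic_distinct_roots:
  fixes a b c :: complex
  assumes "a \<noteq> 0" "b\<^sup>2 - 4 * a * c \<noteq> 0"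
  obtains t u where "t \<noteq> u" "a * t\<^sup>2 + b * t + c = 0" "a * u\<^sup>2 + b * u + c = 0"
proof -
  define d where "d = csqrt (b\<^sup>2 - 4 * a * c)"
  have d: "d\<^sup>2 = b\<^sup>2 - 4 * a * c" "d \<noteq> 0" using assms(2) by (auto simp: d_def)
  have "a * ((- b + e) / (2 * a))\<^sup>2 + b * ((- b + e) / (2 * a)) + c = 0" if "e\<^sup>2 = d\<^sup>2" for e
  proof -
    have "a * ((- b + e) / (2 * a))\<^sup>2 + b * ((- b + e) / (2 * a)) + c
        = (e\<^sup>2 - (b\<^sup>2 - 4 * a * c)) / (4 * a)"
      using assms(1) by (simp add: field_simps power2_eq_square)
    then show ?thesis using that d by simp
  qed
  from this[of d] this[of "- d"] show thesis
    using that[of "(- b + d) / (2 * a)" "(- b + - d) / (2 * a)"] assms(1) d(2)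
    by (auto simp: field_simps)
qed

text \<open>With \<open>a = - 4 * fst E / p\<close> and \<open>b = 4 * snd E / p\<close> this is the
  vertex correspondence, up to a nonzero factor, when its determinant vanishes and
  \<open>fst E\<close> is nonzero.\<close>

lemma correspondence_4_cycle:
  fixes a b :: real
  assumes "a \<noteq> 0"
  obtains t u v w :: complex where "distinct [t, u, v, w]"
    "\<And>x y. x \<in> {t, v} \<Longrightarrow> y \<in> {u, w} \<Longrightarrow>
      of_real a * (x\<^sup>2 + 1) * (y\<^sup>2 + 1) + (of_real a * x + of_real b) * (of_real a * y + of_real b) = 0"
proof -
  txt \<open>The correspondence relates the fibres of \<open>(a x + b) / (x\<^sup>2 + 1)\<close> over \<open>c\<close> and \<open>c' = - a / c\<close>;
    for large \<open>c\<close> neither value is a branch point.\<close>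
  define c where "c = 3 + \<bar>a\<bar> + \<bar>b\<bar> + 4 * \<bar>b / a\<bar>"
  define c' where "c' = - a / c"
  have "0 \<le> 4 * \<bar>b / a\<bar>" "4 * (b / a) \<le> 4 * \<bar>b / a\<bar>" by linarith+
  \<comment> \<open>The second and third bounds make the discriminant over \<open>c\<close>
    negative; the first and fourth make the one over \<open>c'\<close> positive; the first two
    exclude \<open>c = c'\<close>.\<close>
  then have c: "c \<ge> 3" "c > \<bar>a\<bar>" "c - b > \<bar>a\<bar>" "c \<ge> 3 + 4 * (b / a)"
    unfolding c_def by linarith+
  then have "c > 0" by simp
  have "c' \<noteq> 0" using c assms by (simp add: c'_def)
  have "c * c' = - a" using c by (simp add: c'_def)
  have lt: "a\<^sup>2 < c * (c - b)"
  proof -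
    have "a\<^sup>2 \<le> c * \<bar>a\<bar>"
      using mult_right_mono[of "\<bar>a\<bar>" c "\<bar>a\<bar>"] c by (simp add: power2_eq_square)
    also have "\<dots> < c * (c - b)"
      using c by (intro mult_strict_left_mono) auto
    finally show ?thesis .
  qed
  have disc: "(- a)\<^sup>2 - 4 * c * (c - b) \<noteq> 0"
    using lt zero_le_power2[of a] unfolding power2_minus mult.assoc by linarith
  have "c\<^sup>2 - 4 * (b / a) * c \<ge> 3 * c"
    using mult_right_mono[OF c(4), of c] c(1) by (simp add: algebra_simps power2_eq_square)
  then have gt: "c\<^sup>2 - 4 * (b / a) * c - 4 > 0" using c by simp
  have "(- a)\<^sup>2 - 4 * c' * (c' - b) = (a / c)\<^sup>2 * (c\<^sup>2 - 4 * (b / a) * c - 4)"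
    using c assms by (simp add: c'_def field_simps power2_eq_square)
  then have disc': "(- a)\<^sup>2 - 4 * c' * (c' - b) \<noteq> 0" using gt c assms by simp
  have "c * c \<noteq> - a"
  proof -
    have "c \<le> c * c" using c by simp
    with c(2) show ?thesis by linarith
  qed
  then have "c \<noteq> c'" using \<open>c * c' = - a\<close> by auto
  have of_real_disc: "(complex_of_real (- a))\<^sup>2 - 4 * of_real k * of_real (k - b) =
      of_real ((- a)\<^sup>2 - 4 * k * (k - b))" for k
    by simp
  have cdisc: "(complex_of_real (- a))\<^sup>2 - 4 * of_real c * of_real (c - b) \<noteq> 0"
    and cdisc': "(complex_of_real (- a))\<^sup>2 - 4 * of_real c' * of_real (c' - b) \<noteq> 0"
    unfolding of_real_disc of_real_eq_0_iff by (rule disc disc')+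
  have nz: "complex_of_real c \<noteq> 0" "complex_of_real c' \<noteq> 0"
    using \<open>c > 0\<close> \<open>c' \<noteq> 0\<close> by auto
  obtain t v :: complex where tv: "t \<noteq> v" "of_real c * t\<^sup>2 + of_real (- a) * t + of_real (c - b) = 0"
    "of_real c * v\<^sup>2 + of_real (- a) * v + of_real (c - b) = 0"
    by (rule quadratic_distinct_roots[OF nz(1) cdisc])
  obtain u w :: complex where uw: "u \<noteq> w" "of_real c' * u\<^sup>2 + of_real (- a) * u + of_real (c' - b) = 0"
    "of_real c' * w\<^sup>2 + of_real (- a) * w + of_real (c' - b) = 0"
    by (rule quadratic_distinct_roots[OF nz(2) cdisc'])
  have 1: "of_real a * x + of_real b = of_real c * (x\<^sup>2 + 1)" if "x \<in> {t, v}" for x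
    using that tv by (auto simp: algebra_simps)
  have 2: "of_real a * y + of_real b = of_real c' * (y\<^sup>2 + 1)" if "y \<in> {u, w}" for y
    using that uw by (auto simp: algebra_simps)
  \<comment> \<open>A point in both fibres would be a common zero of \<open>x^2 + 1\<close> and
    \<open>a * x + b\<close>, but the zero of the latter is real.\<close>
  have "x \<noteq> y" if "x \<in> {t, v}" "y \<in> {u, w}" for x y
  proof
    assume "x = y"
    then have eq: "of_real c * (x\<^sup>2 + 1) = of_real c' * (x\<^sup>2 + 1)"
      using 1[OF that(1)] 2[OF that(2)] by (simp only:)
    then have sq: "x\<^sup>2 + 1 = 0" using \<open>c \<noteq> c'\<close> by auto
    then have "of_real a * x + of_real b = 0" using 1[OF that(1)] by simp
    then have "x = of_real (- b / a)" using assms by (simp add: field_simps add_eq_0_iff)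
    with sq have "complex_of_real ((b / a)\<^sup>2 + 1) = 0" by simp
    then have "(b / a)\<^sup>2 + 1 = 0" by (simp only: of_real_eq_0_iff)
    then show False using zero_le_power2[of "b / a"] by linarith
  qed
  from this[of t u] this[of t w] this[of v u] this[of v w]
  have "distinct [t, u, v, w]" using tv(1) uw(1) by auto
  moreover have "of_real a * (x\<^sup>2 + 1) * (y\<^sup>2 + 1) +
      (of_real a * x + of_real b) * (of_real a * y + of_real b) = 0"
    if "x \<in> {t, v}" "y \<in> {u, w}" for x y
  proof -
    have "complex_of_real c * of_real c' = - of_real a"
      using \<open>c * c' = - a\<close> by (metis of_real_minus of_real_mult)
    then have "of_real c * (x\<^sup>2 + 1) * (of_real c' * (y\<^sup>2 + 1)) = - of_real a * ((x\<^sup>2 + 1) * (y\<^sup>2 + 1))"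
      by (metis mult.assoc mult.left_commute)
    then show ?thesis unfolding 1[OF that(1)] 2[OF that(2)] by (simp add: mult.assoc)
  qed
  ultimately show thesis by (rule that)
qed

text \<open>This serves the case of a circle centred at the focus, where the vertex form is
  \<open>p^2 * (x^2 + 1) * (y^2 + 1) - 4 * r^2\<close>. The cycle consists of the fibres of
  \<open>x^2 + 1\<close> over \<open>c\<close> and \<open>\<rho> / c\<close>.\<close>

lemma concentric_4_cycle:
  fixes \<rho> :: real
  assumes "\<rho> > 0"
  obtains t u v w :: complex where "distinct [t, u, v, w]"
    "\<And>x y. x \<in> {t, v} \<Longrightarrow> y \<in> {u, w} \<Longrightarrow> (x\<^sup>2 + 1) * (y\<^sup>2 + 1) = of_real \<rho>"
proof -
  \<comment> \<open>This choice gives \<open>\<rho> / c < 1 < c\<close>, so both fibres avoid the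
    branch value 1 and differ from each other.\<close>
  define c where "c = 2 + \<rho>"
  define d where "d = csqrt (of_real (c - 1))"
  define e where "e = csqrt (of_real (\<rho> / c - 1))"
  have c: "c > 0" "\<rho> / c < 1" using assms by (auto simp: c_def)
  have d: "d\<^sup>2 = of_real (c - 1)" and e: "e\<^sup>2 = of_real (\<rho> / c - 1)"
    by (simp_all add: d_def e_def)
  have "\<rho> / c < c" using c(2) assms unfolding c_def by linarith
  have "d\<^sup>2 \<noteq> 0" unfolding d of_real_eq_0_iff using assms by (simp add: c_def)
  moreover have "e\<^sup>2 \<noteq> 0" unfolding e of_real_eq_0_iff using c by simp
  moreover have "d\<^sup>2 \<noteq> e\<^sup>2" unfolding d e of_real_eq_iff using \<open>\<rho> / c < c\<close> by simp
  ultimately have "distinct [d, e, - d, - e]" by auto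
  moreover have "(x\<^sup>2 + 1) * (y\<^sup>2 + 1) = of_real \<rho>" if "x \<in> {d, - d}" "y \<in> {e, - e}" for x y
  proof -
    have "x\<^sup>2 = of_real (c - 1)" "y\<^sup>2 = of_real (\<rho> / c - 1)" using that d e by auto
    then show ?thesis using c by (simp add: field_simps)
  qed
  ultimately show thesis by (rule that)
qed

section \<open>The correspondence between tangents that meet on the circle\<close>

definition vertex_form ::
  "real \<times> real \<Rightarrow> real \<Rightarrow> real \<Rightarrow> complex \<Rightarrow> complex \<Rightarrow> complex \<Rightarrow> complex \<Rightarrow> complex" where
  "vertex_form E r p s t s' t' =
    circle_form E r (of_real p * (t * t' - s * s')) (- of_real p * (s * t' + t * s')) (2 * s * s')"

definition vertex_matrix :: "real \<times> real \<Rightarrow> real \<Rightarrow> real \<Rightarrow> complex^3^3" where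
  "vertex_matrix E r p = vector
    [vector [of_real (p\<^sup>2), 0, of_real (p\<^sup>2)],
     vector [0, of_real (- 4 * p * fst E), of_real (4 * p * snd E)],
     vector [of_real (p\<^sup>2), of_real (4 * p * snd E),
       of_real ((p + 2 * fst E)\<^sup>2 + 4 * (snd E)\<^sup>2 - 4 * r\<^sup>2)]]"

lemma vertex_form_eq:
  "vertex_form E r p s t s' t' =
    (\<Sum>k\<in>UNIV. veronese s t $ k * (vertex_matrix E r p *v veronese s' t') $ k)"
  by (simp add: vertex_form_def circle_form_def vertex_matrix_def veronese_def sum_3 vector_3
      matrix_vector_mult_def power2_eq_square algebra_simps)

text \<open>For nonzero \<open>p\<close> the cubic factor cancels, and what remains is linear in
  \<open>p\<close> with slope \<open>|E|^2\<close>.\<close>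

lemma det_vertex_matrix:
  "det (vertex_matrix E r p) =
    of_real (- 16 * p ^ 3 * (fst E * ((fst E)\<^sup>2 + (snd E)\<^sup>2 - r\<^sup>2) + p * ((fst E)\<^sup>2 + (snd E)\<^sup>2)))"
  by (simp add: vertex_matrix_def det_3 vector_3 power2_eq_square power3_eq_cube algebra_simps)

section \<open>Necessity: from a quadrilateral to the vanishing determinant\<close>

lemma tangent_line_eqI:
  assumes "p \<noteq> 0" "(s, t) \<noteq> (0, 0)" "(s', t') \<noteq> (0, 0)" "s * t' = t * s'"
  shows "tangent_line p s t = tangent_line p s' t'"
proof -
  obtain k where k: "s' = k * s" "t' = k * t"
    \<comment> \<open>The two-dimensional case, obtained by padding both vectors with a zero third
      coordinate.\<close>
    using assms by (auto intro: zero_cross_imp_multiple[of s t 0 t' 0 s'] simp: mult.commute)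
  then have "k \<noteq> 0" using assms(3) by auto
  with k assms show ?thesis
    unfolding tangent_line_def
    by (subst hom_eq_iff) (auto simp: power_mult_distrib algebra_simps power2_eq_square intro!: exI[of _ "k\<^sup>2"])
qed

lemma incident_tangent_line:
  assumes "p \<noteq> 0" "(s, t) \<noteq> (0, 0)" "(x, y, z) \<noteq> (0, 0, 0)"
  shows "incident (hom x y z) (tangent_line p s t) \<longleftrightarrow>
    2 * s\<^sup>2 * x + 2 * s * t * y + of_real p * (s\<^sup>2 + t\<^sup>2) * z = 0"
  using assms unfolding tangent_line_def by (subst incident_hom) auto

text \<open>The coordinates of \<open>P\<close> are \<open>k\<close> times those of the computed
  intersection, and the circle form scales by \<open>k^2\<close>; \<open>k\<close> is nonzero
  because the coordinates of \<open>P\<close> do not all vanish.\<close>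

lemma vertex_on_circle:
  assumes "p \<noteq> 0" "(s, t) \<noteq> (0, 0)" "(s', t') \<noteq> (0, 0)" "s * t' \<noteq> t * s'"
    and "incident P (tangent_line p s t)" "incident P (tangent_line p s' t')"
    and "on_conic P (circle E r)"
  shows "vertex_form E r p s t s' t' = 0"
proof -
  obtain x y z where xyz: "(x, y, z) \<noteq> (0, 0, 0)" "P = hom x y z" by (rule hom_cases)
  have 1: "2 * s\<^sup>2 * x + 2 * s * t * y + of_real p * (s\<^sup>2 + t\<^sup>2) * z = 0"
    and 2: "2 * s'\<^sup>2 * x + 2 * s' * t' * y + of_real p * (s'\<^sup>2 + t'\<^sup>2) * z = 0"
    using assms xyz incident_tangent_line by auto
  obtain k where k: "x = k * (of_real p * (t * t' - s * s'))"
    "y = k * (- of_real p * (s * t' + t * s'))" "z = k * (2 * s * s')"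
    using tangents_intersection[OF _ assms(4) 1 2] assms(1) by auto
  have "circle_form E r x y z = k\<^sup>2 * vertex_form E r p s t s' t'"
    unfolding k vertex_form_def circle_form_def by (simp add: power2_eq_square algebra_simps)
  moreover have "circle_form E r x y z = 0"
    using assms(7) xyz on_circle_hom by blast
  moreover have "k \<noteq> 0" using k xyz(1) by auto
  ultimately show ?thesis by simp
qed

lemma poncelet_quadrilateral_condition:
  assumes "p \<noteq> 0" "poncelet_polygon 4 (circle E r) (parabola p) v l"
  shows "fst E * ((fst E)\<^sup>2 + (snd E)\<^sup>2 - r\<^sup>2) + p * ((fst E)\<^sup>2 + (snd E)\<^sup>2) = 0"
proof -
  have inj: "inj_on l {..<4}"
    and inc: "\<And>i. i < 4 \<Longrightarrow> incident (v i) (l i) \<and> incident (v (Suc i mod 4)) (l i)"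
    and on: "\<And>i. i < 4 \<Longrightarrow> on_conic (v i) (circle E r)"
    using assms(2) by (auto simp: poncelet_polygon_def)
  have "\<forall>i. \<exists>st. i < 4 \<longrightarrow> st \<noteq> (0, 0) \<and> l i = tangent_line p (fst st) (snd st)"
    using assms tangent_to_parabola_iff[OF assms(1)]
    unfolding poncelet_polygon_def by (metis fst_conv snd_conv)
  then obtain st where st: "\<And>i. i < 4 \<Longrightarrow> st i \<noteq> (0, 0)"
    "\<And>i. i < 4 \<Longrightarrow> l i = tangent_line p (fst (st i)) (snd (st i))"
    by metis
  define s where "s = (\<lambda>i. fst (st i))"
  define t where "t = (\<lambda>i. snd (st i))"
  have ne: "(s i, t i) \<noteq> (0, 0)" and l: "l i = tangent_line p (s i) (t i)" if "i < 4" for i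
    using st[OF that] by (auto simp: s_def t_def)
  have dist: "s i * t j \<noteq> t i * s j" if "i < 4" "j < 4" "i \<noteq> j" for i j
    using tangent_line_eqI[OF assms(1) ne ne] that inj l
    by (metis inj_onD lessThan_iff)
  have vert: "vertex_form E r p (s i) (t i) (s j) (t j) = 0"
    if "i < 4" "j < 4" "i \<noteq> j" "k < 4" "incident (v k) (l i)" "incident (v k) (l j)" for i j k
    using that vertex_on_circle[OF assms(1) ne ne dist] on l by metis
  \<comment> \<open>Sides \<open>i\<close> and \<open>i + 1\<close> share the vertex
    \<open>v (i + 1)\<close>; sides 3 and 0 share \<open>v 0\<close> by wrapping around.\<close>
  have "vertex_form E r p (s 0) (t 0) (s 1) (t 1) = 0"
    using vert[of 0 1 1] inc[of 0] inc[of 1] by simp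
  moreover have "vertex_form E r p (s 0) (t 0) (s 3) (t 3) = 0"
    using vert[of 0 3 0] inc[of 0] inc[of 3] by simp
  moreover have "vertex_form E r p (s 2) (t 2) (s 1) (t 1) = 0"
    using vert[of 2 1 2] inc[of 1] inc[of 2] by (simp add: numeral_2_eq_2)
  moreover have "vertex_form E r p (s 2) (t 2) (s 3) (t 3) = 0"
    using vert[of 2 3 3] inc[of 2] inc[of 3] by simp
  ultimately have "det (vertex_matrix E r p) = 0"
    unfolding vertex_form_eq using dist by (intro symmetric_form_4_cycle_imp_det_eq_0[of s t])
  then show ?thesis
    using assms(1) unfolding det_vertex_matrix of_real_eq_0_iff by simp
qed

section \<open>Sufficiency: building a quadrilateral from four parameters\<close>

lemma tangent_line_eq_iff:
  assumes "p \<noteq> 0"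
  shows "tangent_line p 1 t = tangent_line p 1 u \<longleftrightarrow> t = u"
  using assms unfolding tangent_line_def by (subst hom_eq_iff) auto

text \<open>The equal third coordinates force the scaling factor to be 1, so sum and product of the
  parameters agree; by Vieta these determine the unordered pair.\<close>

lemma vertex_eq_iff:
  assumes "p \<noteq> 0"
  shows "hom (of_real p * (t * u - 1)) (- (of_real p * (t + u))) 2 =
      hom (of_real p * (x * y - 1)) (- (of_real p * (x + y))) 2 \<longleftrightarrow>
    t = x \<and> u = y \<or> t = y \<and> u = x"
proof -
  have "hom (of_real p * (t * u - 1)) (- (of_real p * (t + u))) 2 =
      hom (of_real p * (x * y - 1)) (- (of_real p * (x + y))) 2 \<longleftrightarrow> t * u = x * y \<and> t + u = x + y"
    using assms by (subst hom_eq_iff) auto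
  also have "\<dots> \<longleftrightarrow> t = x \<and> u = y \<or> t = y \<and> u = x"
  proof
    assume *: "t * u = x * y \<and> t + u = x + y"
    then have "(t - x) * (t - y) = 0" by algebra
    with * show "t = x \<and> u = y \<or> t = y \<and> u = x" by auto
  qed auto
  finally show ?thesis .
qed

lemma poncelet_quadrilateralI:
  assumes "p \<noteq> 0" "distinct [t, u, v, w]"
    and form: "\<And>x y. x \<in> {t, v} \<Longrightarrow> y \<in> {u, w} \<Longrightarrow> vertex_form E r p 1 x 1 y = 0"
  shows "\<exists>V l. poncelet_polygon 4 (circle E r) (parabola p) V l"
proof -
  define T where "T = (\<lambda>i. [t, u, v, w] ! i)"
  define X where "X = (\<lambda>x y. hom (of_real p * (x * y - 1)) (- (of_real p * (x + y))) 2)"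
  \<comment> \<open>The index \<open>(i + 3) mod 4\<close> is the cyclic predecessor of
    \<open>i\<close>, so \<open>V i\<close> is where side \<open>i\<close> meets the side before
    it.\<close>
  define V where "V = (\<lambda>i. X (T i) (T ((i + 3) mod 4)))"
  define l where "l = (\<lambda>i. tangent_line p 1 (T i))"
  have sets: "{..<4} = {0, 1, 2, 3 :: nat}" by auto
  have all4: "(\<forall>i<4. Q i) \<longleftrightarrow> Q 0 \<and> Q 1 \<and> Q 2 \<and> Q 3" for Q :: "nat \<Rightarrow> bool"
    using sets by (metis (no_types, lifting) insert_iff lessThan_iff singletonD)
  have T: "T 0 = t" "T 1 = u" "T 2 = v" "T 3 = w" by (simp_all add: T_def)
  have V: "V 0 = X t w" "V 1 = X u t" "V 2 = X v u" "V 3 = X w v"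
    using T by (simp_all add: V_def)
  have l: "l 0 = tangent_line p 1 t" "l 1 = tangent_line p 1 u" "l 2 = tangent_line p 1 v"
    "l 3 = tangent_line p 1 w"
    using T by (simp_all add: l_def)
  have X_eq: "X a b = X c d \<longleftrightarrow> a = c \<and> b = d \<or> a = d \<and> b = c" for a b c d
    unfolding X_def by (rule vertex_eq_iff[OF assms(1)])
  have X_inc: "incident (X a b) (tangent_line p 1 a)" "incident (X a b) (tangent_line p 1 b)" for a b
    unfolding X_def using assms(1)
    by (subst incident_tangent_line; simp add: algebra_simps power2_eq_square)+
  have X_on: "on_conic (X a b) (circle E r)" "on_conic (X b a) (circle E r)"
    if "a \<in> {t, v}" "b \<in> {u, w}" for a b
    using form[OF that] unfolding X_def
    by (subst on_circle_hom; simp add: vertex_form_def algebra_simps)+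
  have tan: "tangent_to (tangent_line p 1 a) (parabola p)" for a
    unfolding tangent_to_parabola_iff[OF assms(1)] by (metis Pair_inject one_neq_zero)
  have "inj_on V {..<4}" "inj_on l {..<4}"
    unfolding sets using assms(1,2)
    by (auto simp: V l X_eq tangent_line_eq_iff simp del: One_nat_def)
  moreover have "\<forall>i<4. incident (V i) (l i) \<and> incident (V (Suc i mod 4)) (l i)"
    unfolding all4 by (simp add: V l X_inc numeral_2_eq_2[symmetric] numeral_3_eq_3[symmetric] del: One_nat_def flip: One_nat_def)
  moreover have "\<forall>i<4. on_conic (V i) (circle E r)"
    unfolding all4 by (simp add: V X_on del: One_nat_def)
  moreover have "\<forall>i<4. tangent_to (l i) (parabola p)"
    by (simp add: l_def tan)
  ultimately show ?thesis unfolding poncelet_polygon_def by blast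
qed

lemma poncelet_quadrilateral_exists:
  assumes "p \<noteq> 0" "r > 0"
    and D: "fst E * ((fst E)\<^sup>2 + (snd E)\<^sup>2 - r\<^sup>2) + p * ((fst E)\<^sup>2 + (snd E)\<^sup>2) = 0"
  shows "\<exists>V l. poncelet_polygon 4 (circle E r) (parabola p) V l"
proof (cases "fst E = 0")
  case True
  \<comment> \<open>With \<open>fst E = 0\<close> the condition reduces to
    \<open>p * (snd E)^2 = 0\<close>, so the centre is the focus.\<close>
  then have "snd E = 0" using D assms(1) by simp
  have "4 * r\<^sup>2 / p\<^sup>2 > 0" using assms by simp
  then obtain t u v w :: complex where d: "distinct [t, u, v, w]" and
    F: "\<And>x y. x \<in> {t, v} \<Longrightarrow> y \<in> {u, w} \<Longrightarrow> (x\<^sup>2 + 1) * (y\<^sup>2 + 1) = of_real (4 * r\<^sup>2 / p\<^sup>2)"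
    by (rule concentric_4_cycle) blast
  show ?thesis
  proof (rule poncelet_quadrilateralI[OF assms(1) d])
    fix x y assume "x \<in> {t, v}" "y \<in> {u, w}"
    from F[OF this] have "of_real (p\<^sup>2) * ((x\<^sup>2 + 1) * (y\<^sup>2 + 1)) = of_real (4 * r\<^sup>2)"
      using assms(1) by simp
    then show "vertex_form E r p 1 x 1 y = 0"
      using True \<open>snd E = 0\<close>
      by (simp add: vertex_form_def circle_form_def algebra_simps power2_eq_square)
  qed
next
  case False
  define a where "a = - 4 * fst E / p"
  define b where "b = 4 * snd E / p"
  have "a \<noteq> 0" using False assms(1) by (simp add: a_def)
  then obtain t u v w :: complex where d: "distinct [t, u, v, w]" and
    F: "\<And>x y. x \<in> {t, v} \<Longrightarrow> y \<in> {u, w} \<Longrightarrow>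
      of_real a * (x\<^sup>2 + 1) * (y\<^sup>2 + 1) + (of_real a * x + of_real b) * (of_real a * y + of_real b) = 0"
    by (rule correspondence_4_cycle) blast
  define e1 e2 P R A B where "e1 = complex_of_real (fst E)" "e2 = complex_of_real (snd E)"
    "P = complex_of_real p" "R = complex_of_real r" "A = complex_of_real a" "B = complex_of_real b"
  note defs = this
  have "p * a = - 4 * fst E" "p * b = 4 * snd E"
    using assms(1) by (simp_all add: a_def b_def)
  then have ab: "P * A = - 4 * e1" "P * B = 4 * e2"
    unfolding defs by (metis of_real_minus of_real_mult of_real_numeral)+
  have "complex_of_real (fst E * ((fst E)\<^sup>2 + (snd E)\<^sup>2 - r\<^sup>2) + p * ((fst E)\<^sup>2 + (snd E)\<^sup>2)) = 0"
    unfolding D by simp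
  then have D': "e1 * (e1\<^sup>2 + e2\<^sup>2 - R\<^sup>2) + P * (e1\<^sup>2 + e2\<^sup>2) = 0"
    by (simp add: defs)
  show ?thesis
  proof (rule poncelet_quadrilateralI[OF assms(1) d])
    fix x y assume "x \<in> {t, v}" "y \<in> {u, w}"
    from F[OF this] have F': "A * (x\<^sup>2 + 1) * (y\<^sup>2 + 1) + (A * x + B) * (A * y + B) = 0"
      by (simp add: defs)
    \<comment> \<open>Modulo \<open>D'\<close> and \<open>ab\<close>, this left side is
      \<open>- P^3 / 4\<close> times that of \<open>F'\<close>. The factor \<open>e1\<close> is
      nonzero and cancels afterwards.\<close>
    have "e1 * ((P * (x * y - 1) - e1 * 2)\<^sup>2 + (- P * (x + y) - e2 * 2)\<^sup>2 - (R * 2)\<^sup>2) = 0"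
      using F' D' ab by algebra
    then show "vertex_form E r p 1 x 1 y = 0"
      using False by (simp add: vertex_form_def circle_form_def defs add.commute)
  qed
qed

section \<open>Counting the parabolas that satisfy the linear condition\<close>

lemma poncelet_pair_4_circle_parabola_iff:
  assumes "p \<noteq> 0" "r > 0"
  shows "poncelet_pair 4 (circle E r) (parabola p) \<longleftrightarrow>
    fst E * ((fst E)\<^sup>2 + (snd E)\<^sup>2 - r\<^sup>2) + p * ((fst E)\<^sup>2 + (snd E)\<^sup>2) = 0"
  using assms poncelet_quadrilateral_condition[of p E r] poncelet_quadrilateral_exists[of p r E]
  by (auto simp: poncelet_pair_def smooth_circle smooth_parabola simp del: split_paired_Ex)

lemma parabola_eq_iff:
  assumes "p \<noteq> 0" "q \<noteq> 0"
  shows "parabola p = parabola q \<longleftrightarrow> p = q"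
proof
  assume "parabola p = parabola q"
  \<comment> \<open>The vertex of \<open>parabola p\<close>; on \<open>parabola q\<close> it gives
    \<open>q * (q - p) = 0\<close>.\<close>
  moreover have "on_conic (affine_point (- p / 2, 0)) (parabola p)"
    by (simp add: on_parabola_iff power2_eq_square)
  ultimately have "q = 0 \<or> p = q"
    by (simp add: on_parabola_iff power2_eq_square algebra_simps)
  then show "p = q" using assms by auto
qed simp

lemma ex1_image_iff:
  assumes "inj_on f S"
  shows "(\<exists>!y. y \<in> f ` S \<and> Q y) \<longleftrightarrow> (\<exists>!x. x \<in> S \<and> Q (f x))"
  using assms unfolding inj_on_def by blast

theorem theorem3p4:
  fixes E :: "real \<times> real" and r :: real and \<D> :: plane_conic
  assumes "r > 0" and "\<D> = circle E r"
  shows "(E \<in> directrix_parallel \<longrightarrow>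
            (\<forall>\<P>\<in>confocal_family. poncelet_pair 4 \<D> \<P> \<longleftrightarrow> E = focus)) \<and>
         ((\<exists>!\<P>. \<P> \<in> confocal_family \<and> poncelet_pair 4 \<D> \<P>) \<longleftrightarrow>
            E \<notin> directrix_parallel \<and> \<not> on_conic (affine_point focus) \<D>)"
proof -
  obtain e1 e2 where E: "E = (e1, e2)" by fastforce
  let ?N = "e1\<^sup>2 + e2\<^sup>2"
  have pair: "poncelet_pair 4 \<D> (parabola p) \<longleftrightarrow> e1 * (?N - r\<^sup>2) + p * ?N = 0" if "p \<noteq> 0" for p
    using poncelet_pair_4_circle_parabola_iff[OF that assms(1)] by (simp add: assms(2) E)
  have par: "E \<in> directrix_parallel \<longleftrightarrow> e1 = 0" by (simp add: E directrix_parallel_def)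
  have foc: "E = focus \<longleftrightarrow> ?N = 0" by (simp add: E focus_def sum_power2_eq_zero_iff)
  have on: "on_conic (affine_point focus) \<D> \<longleftrightarrow> ?N = r\<^sup>2"
    by (auto simp: assms(2) E circle_def focus_def on_real_conic_iff)
  \<comment> \<open>For \<open>e1 = 0\<close> the condition reads \<open>p * ?N = 0\<close> with
    \<open>p\<close> nonzero.\<close>
  have a: "poncelet_pair 4 \<D> \<P> \<longleftrightarrow> E = focus" if "e1 = 0" "\<P> \<in> confocal_family" for \<P>
    using that pair by (auto simp: confocal_family_def foc)
  have "(\<exists>!\<P>. \<P> \<in> confocal_family \<and> poncelet_pair 4 \<D> \<P>) \<longleftrightarrow>
      (\<exists>!p. p \<noteq> 0 \<and> poncelet_pair 4 \<D> (parabola p))"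
    using ex1_image_iff[of parabola "{p. p \<noteq> 0}" "poncelet_pair 4 \<D>"]
    by (simp add: inj_on_def parabola_eq_iff confocal_family_def image_Collect)
  also have "\<dots> \<longleftrightarrow> (\<exists>!p. p \<noteq> 0 \<and> e1 * (?N - r\<^sup>2) + p * ?N = 0)" (is "_ \<longleftrightarrow> ?R")
    using pair by (simp cong: conj_cong)
  also have "?R \<longleftrightarrow> e1 \<noteq> 0 \<and> ?N \<noteq> r\<^sup>2"
  proof
    assume ?R
    then obtain p where p: "p \<noteq> 0" "e1 * (?N - r\<^sup>2) + p * ?N = 0"
      and uniq: "\<And>q. q \<noteq> 0 \<Longrightarrow> e1 * (?N - r\<^sup>2) + q * ?N = 0 \<Longrightarrow> q = p" by blast
    \<comment> \<open>If \<open>?N = 0\<close>, the condition does not involve \<open>p\<close>, so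
      \<open>2 * p\<close> would be a second solution.\<close>
    have "?N \<noteq> 0"
      using uniq[of "2 * p"] p by auto
    then show "e1 \<noteq> 0 \<and> ?N \<noteq> r\<^sup>2" using p by auto
  next
    assume *: "e1 \<noteq> 0 \<and> ?N \<noteq> r\<^sup>2"
    then have N: "?N \<noteq> 0" by (simp add: sum_power2_eq_zero_iff)
    have "a * (n - s) + p * n = 0 \<longleftrightarrow> p = a * (s - n) / n" if "n \<noteq> 0" for a n s p :: real
      using that by (auto simp: field_simps)
    note solve = this[OF N]
    \<comment> \<open>The unique root of the linear equation must be nonzero to define a parabola;
      this is where \<open>F\<close> not lying on the circle enters.\<close>
    have "e1 * (r\<^sup>2 - ?N) / ?N \<noteq> 0" using * N by simp
    then show ?R unfolding solve by blast
  qed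
  finally show ?thesis using a by (simp add: par on)
qed

end
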